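(* Let $d\geq 3$ and let $(X,y)$ be any dataset, with data matrix $X\in\mathbb{R}^{d\times n}$ and label vector $y\in\mathbb{R}^n$, such that the columns of $X$ include the eight points listed in the context. Then there exists a non-zero vector $q\in\mathbb{R}^n$ such that, if $y^Tq\neq 0$, no bias-free single hidden layer neural network using ReLU activation can achieve zero error on $(X,y)$; that is, for every width $m\ge 1$, every $W\in\mathbb{R}^{d\times m}$ and every $\alpha\in\mathbb{R}^m$, $$\left\|\frac{1}{\sqrt{m}}\gamma(X^TW)\alpha-y\right\|_2^2\neq 0,\qquad \gamma(z)=(z)_+ .$$
   Context: A dataset consists of $n$ distinct points $x_i\in\mathbb{R}^d$ with $\|x_i\|_2=1$ (the columns of $X$) and labels $y_i\in\mathbb{R}$ (the entries of $y$). For $z\in\mathbb{R}$, $(z)_+=z$ if $z>0$ and $(z)_+=0$ if $z\le 0$; $\gamma$ is applied to matrices entrywise. The bias-free single hidden layer network of width $m$ is $x\mapsto m^{-1/2}\gamma(x^TW)\alpha$. With $s=1/\sqrt{3}$ and $\mathbf{0}\in\mathbb{R}^{d-3}$ the zero vector, the eight points are $(s,s,s,\mathbf{0})$, $(-s,s,s,\mathbf{0})$, $(s,-s,s,\mathbf{0})$, $(s,s,-s,\mathbf{0})$, $(-s,-s,s,\mathbf{0})$, $(-s,s,-s,\mathbf{0})$, $(s,-s,-s,\mathbf{0})$, $(-s,-s,-s,\mathbf{0})$. *)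

theory Defs
  imports "Jordan_Normal_Form.Matrix" "HOL-Analysis.L2_Norm"
begin

definition vec_norm2 :: "real vec \<Rightarrow> real" where
  "vec_norm2 v = L2_set (\<lambda>i. v $ i) {0..<dim_vec v}"

definition relu :: "real \<Rightarrow> real" where
  "relu z = (if z > 0 then z else 0)"

text \<open>The data points are the columns of the data matrix: distinct unit vectors.
  The labels are unconstrained, so a dataset is such a matrix together with any
  vector \<open>y \<in> carrier_vec n\<close>.\<close>

definition data_matrix :: "nat \<Rightarrow> nat \<Rightarrow> real mat \<Rightarrow> bool" where
  "data_matrix d n X \<longleftrightarrow>
     X \<in> carrier_mat d n \<and> distinct (cols X) \<and> (\<forall>x \<in> set (cols X). vec_norm2 x = 1)"

text \<open>Bias-free single hidden layer network with \<open>m\<close> hidden units, evaluated on all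
  columns of \<open>X\<close> at once: entry \<open>i\<close> of the result is the output on column \<open>i\<close>.\<close>

definition network_outputs ::
    "(real \<Rightarrow> real) \<Rightarrow> nat \<Rightarrow> real mat \<Rightarrow> real vec \<Rightarrow> real mat \<Rightarrow> real vec" where
  "network_outputs \<gamma> m W \<alpha> X =
     (1 / sqrt (real m)) \<cdot>\<^sub>v (map_mat \<gamma> (X\<^sup>T * W) *\<^sub>v \<alpha>)"

definition pad3 :: "nat \<Rightarrow> real \<Rightarrow> real \<Rightarrow> real \<Rightarrow> real vec" where
  "pad3 d a b c = vec_of_list [a, b, c] @\<^sub>v 0\<^sub>v (d - 3)"

definition eight_points :: "nat \<Rightarrow> real vec set" where
  "eight_points d = (let s = 1 / sqrt 3 in
     {pad3 d s s s, pad3 d (- s) s s, pad3 d s (- s) s, pad3 d s s (- s),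
      pad3 d (- s) (- s) s, pad3 d (- s) s (- s), pad3 d s (- s) (- s),
      pad3 d (- s) (- s) (- s)})"

end

theory Submission
  imports Defs
begin

text \<open>The eight points are the vertices \<open>(\<plusminus>s, \<plusminus>s, \<plusminus>s)\<close> of a cube. Give each vertex the
  product of its coordinates as weight, so that the weights alternate in sign along the edges
  of the cube. This weight is odd under \<open>v \<mapsto> - v\<close>, and \<open>(z)\<^sub>+ - (- z)\<^sub>+ = z\<close>. Hence summing the
  weighted responses of a ReLU neuron over antipodal pairs replaces the ReLU by the identity,
  and the sum vanishes by the linear dependence
  \<open>(s, s, s) = (-s, s, s) + (s, -s, s) + (s, s, -s)\<close>
  (lemma \<open>eight_points_relu_dependence\<close>).

  The vector \<open>q\<close> of these weights, extended by zero to the other data points, is therefore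
  orthogonal to the response vector of every single neuron, whatever its weights. A network
  output vector is a linear combination of neuron responses, so it is orthogonal to \<open>q\<close> as well
  (lemma \<open>network_outputs_orthogonal\<close>), and it cannot be equal to a label vector \<open>y\<close> that is not
  orthogonal to \<open>q\<close>.\<close>

lemma relu_minus_relu_uminus: "relu z - relu (- z) = z"
  by (simp add: relu_def)

lemma vec_norm2_eq_0_iff:
  assumes "v \<in> carrier_vec n"
  shows "vec_norm2 v = 0 \<longleftrightarrow> v = 0\<^sub>v n"
proof -
  have "vec_norm2 v = 0 \<longleftrightarrow> (\<forall>i < n. v $ i = 0)"
    unfolding vec_norm2_def using assms by (subst L2_set_eq_0_iff) auto
  also have "\<dots> \<longleftrightarrow> v = 0\<^sub>v n"
    using assms by (auto intro: eq_vecI)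
  finally show ?thesis .
qed

lemma pad3_index [simp]:
  shows "pad3 d a b c $ 0 = a" "pad3 d a b c $ Suc 0 = b" "pad3 d a b c $ 2 = c"
  by (auto simp: pad3_def numeral_2_eq_2)

lemma pad3_index_eq_0:
  assumes "3 \<le> i" and "i < d"
  shows "pad3 d a b c $ i = 0"
  using assms by (simp add: pad3_def append_vec_def)

lemma pad3_eq_iff [simp]: "pad3 d a b c = pad3 d a' b' c' \<longleftrightarrow> a = a' \<and> b = b' \<and> c = c'"
proof
  assume eq: "pad3 d a b c = pad3 d a' b' c'"
  show "a = a' \<and> b = b' \<and> c = c'"
    using arg_cong [OF eq, of "\<lambda>v. v $ 0"] arg_cong [OF eq, of "\<lambda>v. v $ Suc 0"]
      arg_cong [OF eq, of "\<lambda>v. v $ 2"]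
    unfolding pad3_index by blast
qed simp

lemma pad3_scalar_prod:
  assumes "3 \<le> d" and "w \<in> carrier_vec d"
  shows "pad3 d a b c \<bullet> w = a * w $ 0 + b * w $ 1 + c * w $ 2"
proof -
  have "pad3 d a b c \<bullet> w = (\<Sum>i = 0..<d. pad3 d a b c $ i * w $ i)"
    using assms by (simp add: scalar_prod_def)
  also have "\<dots> = (\<Sum>i \<in> {0, 1, 2}. pad3 d a b c $ i * w $ i)"
  proof (rule sum.mono_neutral_right)
    show "{0, 1, 2} \<subseteq> {0..<d}"
      using assms(1) by auto
    show "\<forall>i \<in> {0..<d} - {0, 1, 2}. pad3 d a b c $ i * w $ i = 0"
    proof
      fix i assume "i \<in> {0..<d} - {0, 1, 2}"
      then have "3 \<le> i" "i < d" by auto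
      then show "pad3 d a b c $ i * w $ i = 0"
        by (simp add: pad3_index_eq_0)
    qed
  qed simp
  finally show ?thesis
    by (simp add: add.assoc)
qed

text \<open>Four of the vertices, one from each antipodal pair, are \<open>(s, s, s)\<close> and its three neighbours
  on the cube. These have the weights \<open>s\<^sup>3, -s\<^sup>3, -s\<^sup>3, -s\<^sup>3\<close>, which are, up to the factor \<open>s\<^sup>3\<close>, the
  coefficients of a linear dependence; the other four vertices turn the ReLU into the identity.\<close>

lemma eight_points_relu_dependence:
  assumes "3 \<le> d" and "w \<in> carrier_vec d"
  shows "(\<Sum>v \<in> eight_points d. v $ 0 * v $ 1 * v $ 2 * relu (v \<bullet> w)) = 0"
proof -
  define s where "s = 1 / sqrt (3::real)"
  have s: "s \<noteq> 0" "- s \<noteq> s" "s \<noteq> - s"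
    by (auto simp: s_def)
  define r where "r a b c = relu (a * w $ 0 + b * w $ 1 + c * w $ 2)" for a b c
  have antipodes: "r a b c = r (- a) (- b) (- c) + (a * w $ 0 + b * w $ 1 + c * w $ 2)" for a b c
    using relu_minus_relu_uminus [of "a * w $ 0 + b * w $ 1 + c * w $ 2"]
    by (simp add: r_def algebra_simps)
  have alternating_sum: "r s s s - r (- s) s s - r s (- s) s - r s s (- s)
        + r (- s) (- s) s + r (- s) s (- s) + r s (- s) (- s) - r (- s) (- s) (- s) = 0"
    using antipodes [of s s s] antipodes [of "- s" s s]
      antipodes [of s "- s" s] antipodes [of s s "- s"]
    unfolding minus_minus mult_minus_left by linarith
  have "(\<Sum>v \<in> eight_points d. v $ 0 * v $ 1 * v $ 2 * relu (v \<bullet> w)) =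
      (\<Sum>v \<in> eight_points d. v $ 0 * v $ 1 * v $ 2 * r (v $ 0) (v $ 1) (v $ 2))"
    by (rule sum.cong)
      (auto simp: eight_points_def Let_def r_def pad3_scalar_prod [OF assms])
  also have "\<dots> = s * s * s * (r s s s - r (- s) s s - r s (- s) s - r s s (- s)
        + r (- s) (- s) s + r (- s) s (- s) + r s (- s) (- s) - r (- s) (- s) (- s))"
    unfolding eight_points_def Let_def s_def [symmetric]
    using s by (simp add: ring_distribs)
  finally show ?thesis
    unfolding alternating_sum by simp
qed

lemma sum_over_cols:
  assumes "X \<in> carrier_mat d n" and "distinct (cols X)"
  shows "(\<Sum>i = 0..<n. f (col X i)) = (\<Sum>v \<in> set (cols X). f v)"
proof -
  have "(\<Sum>v \<in> set (cols X). f v) = sum_list (map f (cols X))"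
    using assms(2) by (simp add: sum_list_distinct_conv_sum_set)
  also have "\<dots> = (\<Sum>i = 0..<n. f (col X i))"
    using assms(1) by (simp add: sum_list_sum_nth)
  finally show ?thesis by simp
qed

lemma network_outputs_carrier:
  assumes "X \<in> carrier_mat d n"
  shows "network_outputs \<gamma> m W \<alpha> X \<in> carrier_vec n"
  using carrier_matD(2) [OF assms] by (intro carrier_vecI) (simp add: network_outputs_def)

text \<open>Only single neurons need to be tested for orthogonality: a network output vector is a
  linear combination of the columns of \<open>\<gamma>(X\<^sup>T W)\<close>, which are neuron responses.\<close>

lemma network_outputs_orthogonal:
  assumes X: "X \<in> carrier_mat d n" and W: "W \<in> carrier_mat d m"
    and \<alpha>: "\<alpha> \<in> carrier_vec m" and q: "q \<in> carrier_vec n"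
    and neuron: "\<And>w. w \<in> carrier_vec d \<Longrightarrow> (\<Sum>i = 0..<n. \<gamma> (col X i \<bullet> w) * q $ i) = 0"
  shows "network_outputs \<gamma> m W \<alpha> X \<bullet> q = 0"
proof -
  have "(map_mat \<gamma> (X\<^sup>T * W) *\<^sub>v \<alpha>) \<bullet> q =
      (\<Sum>i = 0..<n. (\<Sum>j = 0..<m. \<gamma> (col X i \<bullet> col W j) * \<alpha> $ j) * q $ i)"
    using X W \<alpha> q by (simp add: scalar_prod_def)
  also have "\<dots> = (\<Sum>j = 0..<m. \<alpha> $ j * (\<Sum>i = 0..<n. \<gamma> (col X i \<bullet> col W j) * q $ i))"
    unfolding sum_distrib_left sum_distrib_right
    by (rule trans [OF sum.swap]) (intro sum.cong refl, simp only: mult_ac)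
  also have "\<dots> = 0"
  proof (rule sum.neutral, rule ballI)
    fix j
    have "col W j \<in> carrier_vec d"
      using W by auto
    from neuron [OF this] show "\<alpha> $ j * (\<Sum>i = 0..<n. \<gamma> (col X i \<bullet> col W j) * q $ i) = 0"
      by (simp only: mult_zero_right)
  qed
  finally have "(map_mat \<gamma> (X\<^sup>T * W) *\<^sub>v \<alpha>) \<bullet> q = 0" .
  moreover have "map_mat \<gamma> (X\<^sup>T * W) *\<^sub>v \<alpha> \<in> carrier_vec n"
    using carrier_matD(2) [OF X] by (intro carrier_vecI) simp
  ultimately show ?thesis
    using q by (simp add: network_outputs_def)
qed

theorem corollary2p3:
  fixes d n :: nat and X :: "real mat"
  assumes "d \<ge> 3"
    and "data_matrix d n X"
    and "eight_points d \<subseteq> set (cols X)"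
  shows "\<exists>q \<in> carrier_vec n. q \<noteq> 0\<^sub>v n \<and>
    (\<forall>y \<in> carrier_vec n. y \<bullet> q \<noteq> 0 \<longrightarrow>
      (\<forall>m \<ge> 1. \<forall>W \<in> carrier_mat d m. \<forall>\<alpha> \<in> carrier_vec m.
        (vec_norm2 (network_outputs relu m W \<alpha> X - y))\<^sup>2 \<noteq> 0))"
proof -
  have X: "X \<in> carrier_mat d n" and distinct: "distinct (cols X)"
    using assms(2) by (auto simp: data_matrix_def)
  define weight where
    "weight v = (if v \<in> eight_points d then v $ 0 * v $ 1 * v $ 2 else 0)" for v :: "real vec"
  define q where "q = vec n (\<lambda>i. weight (col X i))"
  have q: "q \<in> carrier_vec n"
    by (simp add: q_def)
  have neuron: "(\<Sum>i = 0..<n. relu (col X i \<bullet> w) * q $ i) = 0" if "w \<in> carrier_vec d" for w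
  proof -
    have "(\<Sum>i = 0..<n. relu (col X i \<bullet> w) * q $ i)
        = (\<Sum>i = 0..<n. relu (col X i \<bullet> w) * weight (col X i))"
      by (simp add: q_def)
    also have "\<dots> = (\<Sum>v \<in> set (cols X). relu (v \<bullet> w) * weight v)"
      by (rule sum_over_cols [OF X distinct])
    also have "\<dots> = (\<Sum>v \<in> eight_points d. relu (v \<bullet> w) * weight v)"
      by (rule sum.mono_neutral_right) (use assms(3) in \<open>auto simp: weight_def\<close>)
    also have "\<dots> = (\<Sum>v \<in> eight_points d. v $ 0 * v $ 1 * v $ 2 * relu (v \<bullet> w))"
      by (rule sum.cong) (auto simp: weight_def)
    also have "\<dots> = 0"
      by (rule eight_points_relu_dependence [OF assms(1) that])
    finally show ?thesis .
  qed
  have "q \<noteq> 0\<^sub>v n"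
  proof -
    define p where "p = pad3 d (1 / sqrt 3) (1 / sqrt 3) (1 / sqrt 3)"
    have p: "p \<in> eight_points d"
      by (simp add: p_def eight_points_def Let_def)
    with assms(3) have "p \<in> set (cols X)" by blast
    with X obtain i where i: "i < n" "col X i = p"
      by (auto simp: cols_def)
    have "q $ i \<noteq> 0"
      using p i by (simp add: q_def weight_def) (simp add: p_def)
    with i show ?thesis by auto
  qed
  moreover have "(vec_norm2 (network_outputs relu m W \<alpha> X - y))\<^sup>2 \<noteq> 0"
    if y: "y \<in> carrier_vec n" "y \<bullet> q \<noteq> 0" and W: "W \<in> carrier_mat d m"
      and \<alpha>: "\<alpha> \<in> carrier_vec m" for y m W \<alpha>
  proof
    let ?o = "network_outputs relu m W \<alpha> X"
    have o: "?o \<in> carrier_vec n"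
      by (rule network_outputs_carrier [OF X])
    then have diff: "?o - y \<in> carrier_vec n"
      using y(1) by simp
    assume "(vec_norm2 (?o - y))\<^sup>2 = 0"
    then have "vec_norm2 (?o - y) = 0" by simp
    then have "?o - y = 0\<^sub>v n"
      by (simp only: vec_norm2_eq_0_iff [OF diff])
    then have "(?o - y) \<bullet> q = 0"
      using q by simp
    moreover have "?o \<bullet> q = 0"
      by (rule network_outputs_orthogonal [OF X W \<alpha> q neuron])
    ultimately show False
      using y(2) by (simp add: minus_scalar_prod_distrib [OF o y(1) q])
  qed
  ultimately show ?thesis
    using q by blast
qed

end
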